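(* Let $r\ge1$ and let $B$ be the commutative ring \[ B = \frac{R\left[b_{i,j} \mid i \in [1,r],\ j \in \mathbb{Z} \right]}{\left(b_{i,j}^2 - \sigma^{-j}((z - \alpha_i)^{n_i}) \mid i \in [1,r],\ j \in \mathbb{Z} \right)} \] associated with $(R,\sigma,f)$ as described in the context. Then $B$ is non-noetherian.
   Context: $\Bbbk$ is an algebraically closed field of characteristic zero. Either (1) $R=\Bbbk[z]$ and $\sigma$ is the automorphism $\sigma(z)=z+1$, or (2) $R=\Bbbk[z,z^{-1}]$ and $\sigma(z)=\xi z$ with $\xi\in\Bbbk^\times$ not a root of unity. $f\in\Bbbk[z]$ is monic with $f(0)\ne0$ in case (2). Put $\sigma_\Bbbk(\lambda)=\lambda-1$ in case (1), $\sigma_\Bbbk(\lambda)=\xi^{-1}\lambda$ in case (2); no two distinct roots of $f$ lie on the same $\sigma_\Bbbk$-orbit. $\alpha_1,\dots,\alpha_r$ are the distinct roots of $f$, with multiplicities $n_1,\dots,n_r$. $[1,r]=\{1,\dots,r\}$. *)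

theory Defs
  imports
    "HOL-Algebra.Ring_Divisibility"
    "HOL-Algebra.Algebraic_Closure_Type"
    "HOL-Library.Poly_Mapping"
begin

section \<open>Integer iterates and orbits of a bijection\<close>

definition int_iter :: "('a \<Rightarrow> 'a) \<Rightarrow> int \<Rightarrow> 'a \<Rightarrow> 'a" where
  "int_iter g j = (if 0 \<le> j then g ^^ nat j else inv_into UNIV g ^^ nat (- j))"

definition int_orbit :: "('a \<Rightarrow> 'a) \<Rightarrow> 'a \<Rightarrow> 'a set" where
  "int_orbit g a = {int_iter g j a | j. True}"

section \<open>The two base rings with their automorphisms\<close>

definition shift_poly :: "'k::comm_ring_1 poly \<Rightarrow> 'k poly" where
  "shift_poly p = pcompose p [:1, 1:]"

lemma shift_poly_simps:
  "shift_poly (p + q) = shift_poly p + shift_poly q"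
  "shift_poly (p * q) = shift_poly p * shift_poly q"
  "shift_poly [:c:] = [:c:]"
  "shift_poly [:0, 1:] = [:0, 1:] + 1"
  by (simp_all add: shift_poly_def pcompose_add pcompose_mult pcompose_pCons one_pCons)

lemma bij_shift_poly: "bij (shift_poly :: 'k::comm_ring_1 poly \<Rightarrow> _)"
proof (rule bijI')
  have inverses: "pcompose (shift_poly p) [:-1, 1:] = p" "shift_poly (pcompose p [:-1, 1:]) = p"
    for p :: "'k poly"
    by (simp_all add: shift_poly_def flip: pcompose_assoc)
      (simp_all add: pcompose_pCons)
  show "(shift_poly p = shift_poly q) = (p = q)" for p q :: "'k poly"
    by (metis inverses(1))
  show "\<exists>p. q = shift_poly p" for q :: "'k poly"
    by (metis inverses(2))
qed

text \<open>
  A Laurent polynomial in \<open>z\<close> is the finitely supported function sending \<open>n\<close> to the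
  coefficient of \<open>z\<^sup>n\<close>; the product of \<^typ>\<open>int \<Rightarrow>\<^sub>0 'k\<close> is convolution.
\<close>

type_synonym 'k laurent_poly = "int \<Rightarrow>\<^sub>0 'k"

definition laurent_const :: "'k::zero \<Rightarrow> 'k laurent_poly" where
  "laurent_const c = Poly_Mapping.single 0 c"

definition laurent_z :: "'k::zero_neq_one laurent_poly" where
  "laurent_z = Poly_Mapping.single 1 1"

text \<open>
  The substitution \<open>z \<mapsto> \<xi> z\<close> multiplies the coefficient of \<open>z\<^sup>n\<close> by \<open>\<xi>\<^sup>n\<close>.
\<close>

definition scale_laurent :: "'k::field \<Rightarrow> 'k laurent_poly \<Rightarrow> 'k laurent_poly" where
  "scale_laurent \<xi> p = Poly_Mapping.mapp (\<lambda>n c. \<xi> powi n * c) p"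

lemma lookup_scale_laurent:
  "Poly_Mapping.lookup (scale_laurent \<xi> p) n = \<xi> powi n * Poly_Mapping.lookup p n"
  by (auto simp: scale_laurent_def lookup_mapp when_def in_keys_iff)

lemma scale_laurent_add: "scale_laurent \<xi> (p + q) = scale_laurent \<xi> p + scale_laurent \<xi> q"
  by (rule poly_mapping_eqI) (simp add: lookup_scale_laurent lookup_add algebra_simps)

lemma scale_laurent_single:
  "scale_laurent \<xi> (Poly_Mapping.single n c) = Poly_Mapping.single n (\<xi> powi n * c)"
  by (rule poly_mapping_eqI) (simp add: lookup_scale_laurent lookup_single when_def)

lemma scale_laurent_const: "scale_laurent \<xi> (laurent_const c) = laurent_const c"
  by (simp add: laurent_const_def scale_laurent_single)

lemma scale_laurent_z: "scale_laurent \<xi> laurent_z = laurent_const \<xi> * laurent_z"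
  by (simp add: laurent_const_def laurent_z_def scale_laurent_single Poly_Mapping.mult_single)

lemma poly_mapping_sum_induct [case_names zero single sum]:
  fixes p :: "'a \<Rightarrow>\<^sub>0 'b::monoid_add"
  assumes "P 0" "\<And>a b. P (Poly_Mapping.single a b)" "\<And>p q. P p \<Longrightarrow> P q \<Longrightarrow> P (p + q)"
  shows "P p"
proof (induction p rule: update_induct)
  case (update f a b)
  have "Poly_Mapping.update a b f = Poly_Mapping.single a b + f"
    using update(1)
    by (intro poly_mapping_eqI)
      (auto simp: lookup_add lookup_single lookup_update when_def in_keys_iff)
  then show ?case using assms update by simp
qed (rule assms)

lemma scale_laurent_zero: "scale_laurent \<xi> 0 = 0"
  by (rule poly_mapping_eqI) (simp add: lookup_scale_laurent)

lemma scale_laurent_mult: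
  assumes "\<xi> \<noteq> 0"
  shows "scale_laurent \<xi> (p * q) = scale_laurent \<xi> p * scale_laurent \<xi> q"
proof (induction p rule: poly_mapping_sum_induct)
  case zero
  then show ?case by (simp add: scale_laurent_zero)
next
  case (single m a)
  show ?case
  proof (induction q rule: poly_mapping_sum_induct)
    case zero
    then show ?case by (simp add: scale_laurent_zero)
  next
    case (single n b)
    show ?case
      using assms
      by (simp add: scale_laurent_single Poly_Mapping.mult_single power_int_add ac_simps)
  next
    case (sum p q)
    then show ?case by (simp add: scale_laurent_add algebra_simps)
  qed
next
  case (sum p q)
  then show ?case by (simp add: scale_laurent_add algebra_simps)
qed

lemma bij_scale_laurent:
  assumes "\<xi> \<noteq> 0"
  shows "bij (scale_laurent \<xi>)"
proof (rule bijI')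
  have inverses: "scale_laurent (inverse \<xi>) (scale_laurent \<xi> p) = p"
    "scale_laurent \<xi> (scale_laurent (inverse \<xi>) p) = p" for p
    using assms
    by (auto intro!: poly_mapping_eqI simp: lookup_scale_laurent power_int_inverse)
  show "(scale_laurent \<xi> p = scale_laurent \<xi> q) = (p = q)" for p q
    by (metis inverses(1))
  show "\<exists>p. q = scale_laurent \<xi> p" for q
    by (metis inverses(2))
qed

section \<open>Polynomials in the indeterminates \<open>b\<^sub>i\<^sub>,\<^sub>j\<close> and the ring \<open>B\<close>\<close>

text \<open>
  The type \<^typ>\<open>('v \<Rightarrow>\<^sub>0 nat) \<Rightarrow>\<^sub>0 'r\<close> carries the polynomial ring over \<^typ>\<open>'r\<close> with all elements
  of \<^typ>\<open>'v\<close> as indeterminates; monomials are exponent vectors \<^typ>\<open>'v \<Rightarrow>\<^sub>0 nat\<close>.  Restricting the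
  carrier to polynomials whose monomials are supported on \<open>V\<close> gives the polynomial ring on \<open>V\<close>.
\<close>

type_synonym ('v, 'r) mpoly_over = "('v \<Rightarrow>\<^sub>0 nat) \<Rightarrow>\<^sub>0 'r"

definition mvar :: "'v \<Rightarrow> ('v, 'r::zero_neq_one) mpoly_over" where
  "mvar v = Poly_Mapping.single (Poly_Mapping.single v 1) 1"

definition mconst :: "'r::zero \<Rightarrow> ('v, 'r) mpoly_over" where
  "mconst c = Poly_Mapping.single 0 c"

definition mpoly_ring :: "'v set \<Rightarrow> ('v, 'r::comm_ring_1) mpoly_over ring" where
  "mpoly_ring V =
     ring_of_type_algebra
       \<lparr>carrier := {p. \<forall>m\<in>Poly_Mapping.keys p. Poly_Mapping.keys m \<subseteq> V}\<rparr>"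

definition B_indets :: "nat \<Rightarrow> (nat \<times> int) set" where
  "B_indets r = {1..r} \<times> UNIV"

text \<open>Here \<open>g i\<close> is the element \<open>(z - \<alpha>\<^sub>i)\<close> raised to the power \<open>n\<^sub>i\<close> of the base ring.\<close>

definition B_relations ::
  "('r \<Rightarrow> 'r) \<Rightarrow> (nat \<Rightarrow> 'r) \<Rightarrow> nat \<Rightarrow> (nat \<times> int, 'r::comm_ring_1) mpoly_over set" where
  "B_relations \<sigma> g r =
     {mvar (i, j) ^ 2 - mconst (int_iter \<sigma> (- j) (g i)) | i j. i \<in> {1..r}}"

definition B_ring ::
  "('r \<Rightarrow> 'r) \<Rightarrow> (nat \<Rightarrow> 'r) \<Rightarrow> nat \<Rightarrow> (nat \<times> int, 'r::comm_ring_1) mpoly_over set ring" where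
  "B_ring \<sigma> g r =
     mpoly_ring (B_indets r) Quot (Idl\<^bsub>mpoly_ring (B_indets r)\<^esub> (B_relations \<sigma> g r))"

lemma mpoly_ring_simps:
  "carrier (mpoly_ring V) = {p. \<forall>m\<in>Poly_Mapping.keys p. Poly_Mapping.keys m \<subseteq> V}"
  "x \<oplus>\<^bsub>mpoly_ring V\<^esub> y = x + y" "x \<otimes>\<^bsub>mpoly_ring V\<^esub> y = x * y"
  "\<zero>\<^bsub>mpoly_ring V\<^esub> = 0" "\<one>\<^bsub>mpoly_ring V\<^esub> = 1"
  by (simp_all add: mpoly_ring_def ring_of_type_algebra_def)

lemma mpoly_ring_mult_closed:
  fixes p q :: "('v, 'r::comm_ring_1) mpoly_over"
  assumes "p \<in> carrier (mpoly_ring V)" "q \<in> carrier (mpoly_ring V)"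
  shows "p * q \<in> carrier (mpoly_ring V)"
proof -
  have "Poly_Mapping.keys m \<subseteq> V" if m: "m \<in> Poly_Mapping.keys (p * q)" for m
  proof -
    obtain a b where "a \<in> Poly_Mapping.keys p" "b \<in> Poly_Mapping.keys q" "m = a + b"
      using m Poly_Mapping.keys_mult[of p q] by blast
    then show ?thesis
      using assms Poly_Mapping.keys_add[of a b] unfolding mpoly_ring_simps by blast
  qed
  then show ?thesis by (simp add: mpoly_ring_simps)
qed

lemma mpoly_ring_add_closed:
  fixes p q :: "('v, 'r::comm_ring_1) mpoly_over"
  assumes "p \<in> carrier (mpoly_ring V)" "q \<in> carrier (mpoly_ring V)"
  shows "p + q \<in> carrier (mpoly_ring V)"
  using assms Poly_Mapping.keys_add[of p q] unfolding mpoly_ring_simps by blast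

lemma mpoly_ring_zero_one_closed:
  "0 \<in> carrier (mpoly_ring V)" "1 \<in> carrier (mpoly_ring V)"
  by (auto simp: mpoly_ring_simps simp flip: single_one)

lemma mpoly_ring_cring: "cring (mpoly_ring V :: ('v, 'r::comm_ring_1) mpoly_over ring)"
proof (rule cringI)
  note ring_ops = mpoly_ring_simps(2-5) mpoly_ring_add_closed mpoly_ring_mult_closed
    mpoly_ring_zero_one_closed
  show "abelian_group (mpoly_ring V :: ('v, 'r) mpoly_over ring)"
  proof (rule abelian_groupI)
    fix x :: "('v, 'r) mpoly_over"
    assume "x \<in> carrier (mpoly_ring V)"
    then show "\<exists>y\<in>carrier (mpoly_ring V). y \<oplus>\<^bsub>mpoly_ring V\<^esub> x = \<zero>\<^bsub>mpoly_ring V\<^esub>"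
      by (intro bexI[of _ "- x"]) (auto simp: mpoly_ring_simps keys_minus)
  qed (simp_all add: ring_ops ac_simps)
  show "Group.comm_monoid (mpoly_ring V :: ('v, 'r) mpoly_over ring)"
    by (rule comm_monoidI) (simp_all add: ring_ops ac_simps)
qed (simp add: mpoly_ring_simps distrib_right)

lemma B_relations_subset: "B_relations \<sigma> g r \<subseteq> carrier (mpoly_ring (B_indets r))"
proof
  fix x
  assume "x \<in> B_relations \<sigma> g r"
  then obtain i j where x: "x = mvar (i, j) ^ 2 + mconst (- int_iter \<sigma> (- j) (g i))"
    and i: "i \<in> {1..r}"
    by (auto simp: B_relations_def mconst_def single_uminus)
  have "mvar (i, j) \<in> carrier (mpoly_ring (B_indets r))"
    using i by (auto simp: mvar_def mpoly_ring_simps B_indets_def)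
  moreover have "mconst c \<in> carrier (mpoly_ring (B_indets r))" for c
    by (auto simp: mconst_def mpoly_ring_simps)
  ultimately show "x \<in> carrier (mpoly_ring (B_indets r))"
    unfolding x power2_eq_square by (intro mpoly_ring_add_closed mpoly_ring_mult_closed)
qed

lemma B_ring_cring: "cring (B_ring \<sigma> g r)"
  unfolding B_ring_def
  by (intro ideal.quotient_is_cring ring.genideal_ideal B_relations_subset mpoly_ring_cring
      cring.axioms(1)[OF mpoly_ring_cring])

end

theory Submission
  imports Defs
begin

text \<open>
  Evaluate \<open>z\<close> at a point \<open>c\<close> where none of the right-hand sides of the relations
  for \<open>b\<^bsub>1,-m\<^esub>\<close>, \<open>m \<ge> 0\<close>, vanishes: \<open>c = \<alpha>\<^sub>1 + 1\<close> in case (1) and \<open>c = \<xi> \<alpha>\<^sub>1\<close> in case (2).  Choosing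
  a square root \<open>s\<^bsub>i,j\<^esub>\<close> for the value of each \<open>b\<^bsub>i,j\<^esub>\<close> gives a point of \<open>B\<close>; let \<open>t\<^sub>m\<close> be the point
  that differs from it only in the sign of \<open>s\<^bsub>1,-m\<^esub>\<close>.  The ideals \<open>K\<^sub>n\<close> of the elements vanishing at
  \<open>t\<^sub>m\<close> for all \<open>m \<ge> n\<close> ascend strictly, since \<open>b\<^bsub>1,-n\<^esub> - s\<^bsub>1,-n\<^esub>\<close> vanishes at \<open>t\<^sub>m\<close> exactly if \<open>m \<noteq> n\<close>.
\<close>

text \<open>Ideals containing \<open>J\<close> correspond to ideals of the quotient. In a noetherian
  quotient the union of the chain of images of the \<open>K n\<close> would be one of these images,
  so the chain would become constant, and so would its pullback, the \<open>K n\<close>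
  themselves.\<close>

lemma (in ring) not_noetherian_quotient:
  fixes K :: "nat \<Rightarrow> 'a set"
  assumes J: "ideal J R" and K: "\<And>n. ideal (K n) R" and JK: "\<And>n. J \<subseteq> K n"
    and strict: "\<And>n. K n \<subset> K (Suc n)"
  shows "\<not> noetherian_ring (R Quot J)"
proof
  assume "noetherian_ring (R Quot J)"
  then interpret Q: noetherian_ring "R Quot J" .
  let ?P = "\<lambda>n. (+>) J ` K n"
  have mono: "K i \<subseteq> K j" if "i \<le> j" for i j
    using lift_Suc_mono_le[of K i j] strict that by blast
  have "subset.chain {I. ideal I (R Quot J)} (range ?P)"
    unfolding subset_chain_def
  proof (intro conjI ballI subsetI)
    fix I assume "I \<in> range ?P"
    then show "I \<in> {I. ideal I (R Quot J)}"
      using ring_ideal_imp_quot_ideal[OF J K] by auto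
  next
    fix A B assume "A \<in> range ?P" "B \<in> range ?P"
    then obtain i j where ij: "A = ?P i" "B = ?P j"
      by auto
    show "A \<subseteq> B \<or> B \<subseteq> A"
      unfolding ij using nat_le_linear[of i j]
      by (rule disj_forward) (intro image_mono mono; assumption)+
  qed
  then have "\<Union> (range ?P) \<in> range ?P"
    by (intro Q.ideal_chain_is_trivial) auto
  then obtain n where n: "\<Union> (range ?P) = ?P n"
    by auto
  obtain x where x: "x \<in> K (Suc n)" "x \<notin> K n"
    using strict[of n] by blast
  have xR: "x \<in> carrier R"
    using x(1) ideal.Icarr[OF K] by blast
  have "J +> x \<in> ?P n"
    using x(1) n by blast
  then obtain y where y: "y \<in> K n" "J +> x = J +> y"
    by auto
  \<comment> \<open>Equality of the two cosets writes \<open>x\<close> as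
    \<open>j \<oplus> y\<close> with \<open>j\<close> in \<open>J\<close>; both summands lie in
    \<open>K n\<close> because \<open>J \<subseteq> K n\<close>.\<close>
  have "x \<in> J +> x"
    by (rule abelian_subgroup.a_rcos_self
        [OF abelian_subgroupI3[OF ideal.axioms(1)[OF J] abelian_group_axioms] xR])
  then have "x \<in> (\<Union>j\<in>J. {j \<oplus> y})"
    unfolding y(2) by (simp only: a_r_coset_def')
  then obtain j where j: "j \<in> J" "x = j \<oplus> y"
    by (elim UN_E singletonE)
  have "j \<oplus> y \<in> K n"
    by (rule additive_subgroup.a_closed[OF ideal.axioms(1)[OF K] subsetD[OF JK j(1)] y(1)])
  then have "x \<in> K n"
    by (simp only: j(2))
  with x(2) show False ..
qed

text \<open>One evaluation serves both kinds of ring: Laurent polynomials form the monoid algebra of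
  \<open>int\<close>, polynomials in the indeterminates that of the exponent vectors. A ring
  homomorphism \<open>h\<close> on coefficients and a character \<open>\<chi>\<close> of the monoid
  together induce a ring homomorphism.\<close>

definition monoid_algebra_eval ::
  "('r::zero \<Rightarrow> 's) \<Rightarrow> ('a \<Rightarrow> 's) \<Rightarrow> ('a \<Rightarrow>\<^sub>0 'r) \<Rightarrow> 's::comm_ring_1" where
  "monoid_algebra_eval h \<chi> p = (\<Sum>m. h (Poly_Mapping.lookup p m) * \<chi> m)"

locale monoid_algebra_hom =
  fixes h :: "'r::comm_ring_1 \<Rightarrow> 's::comm_ring_1" and \<chi> :: "'a::comm_monoid_add \<Rightarrow> 's"
  assumes h_one: "h 1 = 1" and h_add: "h (a + b) = h a + h b" and h_mult: "h (a * b) = h a * h b"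
    and chi_zero: "\<chi> 0 = 1" and chi_add: "\<chi> (u + v) = \<chi> u * \<chi> v"
begin

abbreviation "ev \<equiv> monoid_algebra_eval h \<chi>"

lemma h_zero: "h 0 = 0"
  using h_add[of 0 0] by simp

lemma ev_zero: "ev 0 = 0"
  by (simp add: monoid_algebra_eval_def h_zero)

lemma ev_single: "ev (Poly_Mapping.single m a) = h a * \<chi> m"
proof -
  have "ev (Poly_Mapping.single m a) = (\<Sum>k. h a * \<chi> k when k = m)"
    unfolding monoid_algebra_eval_def
    by (intro Sum_any.cong) (simp add: lookup_single when_def h_zero)
  then show ?thesis
    by simp
qed

lemma ev_add: "ev (p + q) = ev p + ev q"
proof -
  have finite: "finite {m. h (Poly_Mapping.lookup p m) * \<chi> m \<noteq> 0}" for p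
    by (rule finite_subset[OF _ finite_keys[of p]]) (auto simp: in_keys_iff h_zero)
  show ?thesis
    unfolding monoid_algebra_eval_def
    by (simp add: lookup_add h_add distrib_right Sum_any.distrib finite)
qed

lemma ev_one: "ev 1 = 1"
  using ev_single[of 0 1] by (simp add: h_one chi_zero)

lemma ev_mult: "ev (p * q) = ev p * ev q"
proof (induction p rule: poly_mapping_sum_induct)
  case (single m a)
  show ?case
  proof (induction q rule: poly_mapping_sum_induct)
    case (single n b)
    show ?case
      by (simp add: Poly_Mapping.mult_single ev_single h_mult chi_add)
  qed (simp_all add: ev_zero ev_add distrib_left)
qed (simp_all add: ev_zero ev_add distrib_right)

lemma ev_diff: "ev (p - q) = ev p - ev q"
  using ev_add[of "p - q" q] by simp

lemma ev_power: "ev (p ^ n) = ev p ^ n"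
  by (induction n) (simp_all add: ev_one ev_mult)

end

text \<open>The character of the exponent monoid attached to a point \<open>s\<close>. With
  infinitely many indeterminates the product still makes sense, since an exponent vector has finite
  support.\<close>

definition monomial_eval :: "('v \<Rightarrow> 's::comm_monoid_mult) \<Rightarrow> ('v \<Rightarrow>\<^sub>0 nat) \<Rightarrow> 's" where
  "monomial_eval s m = (\<Prod>v. s v ^ Poly_Mapping.lookup m v)"

lemma monomial_eval_zero: "monomial_eval s 0 = 1"
  by (simp add: monomial_eval_def)

lemma monomial_eval_single: "monomial_eval s (Poly_Mapping.single v k) = s v ^ k"
proof -
  have "monomial_eval s (Poly_Mapping.single v k) = (\<Prod>w. if w = v then s w ^ k else 1)"
    unfolding monomial_eval_def
    by (intro Prod_any.cong) (simp add: lookup_single when_def)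
  then show ?thesis
    by simp
qed

lemma monomial_eval_add: "monomial_eval s (m + m') = monomial_eval s m * monomial_eval s m'"
proof -
  have finite: "finite {v. s v ^ Poly_Mapping.lookup m v \<noteq> 1}" for m
    by (rule finite_subset[OF _ finite_keys[of m]]) (auto simp: in_keys_iff intro!: gr0I)
  show ?thesis
    unfolding monomial_eval_def by (simp add: lookup_add power_add Prod_any.distrib finite)
qed

text \<open>This is an intersection of kernels of evaluation homomorphisms.\<close>

lemma ideal_mpoly_ring_vanishing:
  fixes h :: "'r::comm_ring_1 \<Rightarrow> 's::comm_ring_1" and S :: "('v \<Rightarrow> 's) set"
  assumes "\<And>s. s \<in> S \<Longrightarrow> monoid_algebra_hom h (monomial_eval s)"
  shows "ideal {p \<in> carrier (mpoly_ring V). \<forall>s\<in>S. monoid_algebra_eval h (monomial_eval s) p = 0}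
    (mpoly_ring V)"
    (is "ideal ?I ?M")
proof -
  interpret M: cring ?M
    by (rule mpoly_ring_cring)
  note ev = monoid_algebra_hom.ev_zero[OF assms] monoid_algebra_hom.ev_add[OF assms]
    monoid_algebra_hom.ev_mult[OF assms] monoid_algebra_hom.ev_diff[OF assms]
  show ?thesis
  proof (rule idealI[OF M.ring_axioms])
    show "subgroup ?I (add_monoid ?M)"
    proof (rule M.add.subgroupI)
      show "?I \<noteq> {}"
        using M.zero_closed by (auto simp: mpoly_ring_simps ev intro!: exI[of _ 0])
    next
      fix p assume p: "p \<in> ?I"
      have neg: "\<ominus>\<^bsub>?M\<^esub> p = - p"
        using p by (intro M.minus_equality) (auto simp: mpoly_ring_simps keys_minus)
      then show "\<ominus>\<^bsub>?M\<^esub> p \<in> ?I"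
        using p M.a_inv_closed[of p] ev(4)[of _ 0 p] by (simp add: neg ev)
    qed (auto simp: mpoly_ring_simps(2) ev mpoly_ring_add_closed)
  qed (auto simp: mpoly_ring_simps(3) ev mpoly_ring_mult_closed)
qed

text \<open>Here \<open>h\<close> stands for evaluation of the base ring at the chosen point. The
  hypothesis \<open>nz\<close> concerns the relations with index \<open>(1, - int k)\<close>;
  surjectivity allows the chosen square roots to be lifted to constants of the base ring.\<close>

lemma not_noetherian_B_ring:
  fixes h :: "'r::comm_ring_1 \<Rightarrow> 'k::{alg_closed_field, field_char_0}"
  assumes r: "r \<ge> 1"
    and h: "h 1 = 1" "\<And>a b. h (a + b) = h a + h b" "\<And>a b. h (a * b) = h a * h b" "surj h"
    and nz: "\<And>k. h ((\<sigma> ^^ k) (g 1)) \<noteq> 0"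
  shows "\<not> noetherian_ring (B_ring \<sigma> g r)"
proof -
  let ?M = "mpoly_ring (B_indets r) :: (nat \<times> int, 'r) mpoly_over ring"
  let ?ev = "\<lambda>s :: nat \<times> int \<Rightarrow> 'k. monoid_algebra_eval h (monomial_eval s)"
  interpret M: cring ?M
    by (rule mpoly_ring_cring)
  have hom: "monoid_algebra_hom h (monomial_eval s)" for s :: "nat \<times> int \<Rightarrow> 'k"
    by unfold_locales (simp_all add: h monomial_eval_zero monomial_eval_add)
  note ev_diff = monoid_algebra_hom.ev_diff[OF hom]
    and ev_power = monoid_algebra_hom.ev_power[OF hom]
  have ev_mvar: "?ev s (mvar v) = s v" for s v
    by (simp add: mvar_def monoid_algebra_hom.ev_single[OF hom] h monomial_eval_single)
  have ev_mconst: "?ev s (mconst a) = h a" for s a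
    by (simp add: mconst_def monoid_algebra_hom.ev_single[OF hom] monomial_eval_zero)
  \<comment> \<open>The square roots exist because \<open>'k\<close> is algebraically
    closed.\<close>
  define s where "s = (\<lambda>(i, j). SOME y. y ^ 2 = h (int_iter \<sigma> (- j) (g i)))"
  have s: "s (i, j) ^ 2 = h (int_iter \<sigma> (- j) (g i))" for i j
    unfolding s_def using someI_ex[OF nth_root_exists[of 2]] by simp
  define t where "t = (\<lambda>m::nat. s((1, - int m) := - s (1, - int m)))"
  \<comment> \<open>A change of sign does not affect squares, so each \<open>t m\<close> still
    satisfies every relation.\<close>
  have t: "t m (i, j) ^ 2 = h (int_iter \<sigma> (- j) (g i))" for m i j
    by (simp add: t_def s)
  define K where "K n = {p \<in> carrier ?M. \<forall>u\<in>t ` {n..}. ?ev u p = 0}" for n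
  have K: "ideal (K n) ?M" for n
    unfolding K_def by (rule ideal_mpoly_ring_vanishing) (rule hom)
  have "B_relations \<sigma> g r \<subseteq> K n" for n
  proof
    fix p assume p: "p \<in> B_relations \<sigma> g r"
    then have "?ev (t m) p = 0" for m
      by (auto simp: B_relations_def ev_diff ev_power ev_mvar ev_mconst t)
    with p B_relations_subset show "p \<in> K n"
      by (auto simp: K_def)
  qed
  then have JK: "Idl\<^bsub>?M\<^esub> (B_relations \<sigma> g r) \<subseteq> K n" for n
    by (rule M.genideal_minimal[OF K])
  have "K n \<subset> K (Suc n)" for n
  proof
    show "K n \<subseteq> K (Suc n)"
      by (auto simp: K_def)
    let ?v = "(1, - int n)"
    \<comment> \<open>The number \<open>s ?v\<close> lies in \<open>'k\<close>, not in the base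
      ring; a preimage under \<open>h\<close> makes the separating element a polynomial over the
      base ring.\<close>
    obtain a where a: "h a = s ?v"
      using surjD[OF h(4)] by metis
    define x :: "(nat \<times> int, 'r) mpoly_over" where "x = mvar ?v - mconst a"
    have ev_x: "?ev u x = u ?v - s ?v" for u
      by (simp add: x_def ev_diff ev_mvar ev_mconst a)
    have "mvar ?v + mconst (- a) \<in> carrier ?M"
      using r by (intro mpoly_ring_add_closed)
        (auto simp: mvar_def mconst_def mpoly_ring_simps B_indets_def)
    then have "x \<in> carrier ?M"
      by (simp add: x_def mconst_def single_uminus)
    moreover have "t m ?v = s ?v" if "m > n" for m
      using that by (simp add: t_def)
    ultimately have "x \<in> K (Suc n)"
      by (auto simp: K_def ev_x)
    \<comment> \<open>The two minus signs cancel: the relation for \<open>?v\<close> involves the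
      forward iterate \<open>\<sigma> ^^ n\<close>.\<close>
    moreover have "s ?v \<noteq> 0"
      using s[of 1 "- int n"] nz[of n] by (auto simp: int_iter_def)
    \<comment> \<open>The value is \<open>- 2 * s ?v\<close>, nonzero in characteristic
      zero.\<close>
    then have "?ev (t n) x \<noteq> 0"
      by (simp add: ev_x t_def eq_neg_iff_add_eq_0 flip: mult_2)
    then have "x \<notin> K n"
      by (auto simp: K_def)
    ultimately show "K n \<noteq> K (Suc n)"
      by blast
  qed
  then show ?thesis
    unfolding B_ring_def
    by (intro M.not_noetherian_quotient[OF _ K JK] M.genideal_ideal B_relations_subset)
qed

theorem theorem5p7:
  fixes f :: "'k::{alg_closed_field, field_char_0} poly"
    and \<alpha> :: "nat \<Rightarrow> 'k" and n :: "nat \<Rightarrow> nat" and r :: nat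
  assumes "lead_coeff f = 1"
    and "r \<ge> 1"
    and "bij_betw \<alpha> {1..r} {a. poly f a = 0}"
    and "\<forall>i\<in>{1..r}. n i = Polynomial.order (\<alpha> i) f"
  shows
    "((\<forall>a b. poly f a = 0 \<and> poly f b = 0 \<and> a \<noteq> b \<longrightarrow> b \<notin> int_orbit (\<lambda>x. x - 1) a)
        \<longrightarrow> \<not> noetherian_ring (B_ring shift_poly (\<lambda>i. [:- \<alpha> i, 1:] ^ n i) r))
     \<and>
     (\<forall>\<xi>::'k. \<xi> \<noteq> 0 \<and> (\<forall>m::nat. m > 0 \<longrightarrow> \<xi> ^ m \<noteq> 1) \<and> poly f 0 \<noteq> 0
        \<and> (\<forall>a b. poly f a = 0 \<and> poly f b = 0 \<and> a \<noteq> b \<longrightarrow> b \<notin> int_orbit (\<lambda>x. inverse \<xi> * x) a)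
        \<longrightarrow> \<not> noetherian_ring
               (B_ring (scale_laurent \<xi>) (\<lambda>i. (laurent_z - laurent_const (\<alpha> i)) ^ n i) r))"
proof (intro conjI impI allI)
  show "\<not> noetherian_ring (B_ring shift_poly (\<lambda>i. [:- \<alpha> i, 1:] ^ n i) r)"
  \<comment> \<open>Shifting a polynomial translates the evaluation point, so the
    \<open>k\<close>-th iterate takes the value \<open>(k + 1) ^ n 1\<close>. Starting at
    \<open>\<alpha> 1\<close> itself would give \<open>0\<close> at \<open>k = 0\<close>.\<close>
  proof (rule not_noetherian_B_ring[where h = "\<lambda>p. poly p (\<alpha> 1 + 1)"])
    have "poly ((shift_poly ^^ k) p) c = poly p (c + of_nat k)" for k and p :: "'k poly" and c
      by (induction k arbitrary: c) (simp_all add: shift_poly_def poly_pcompose algebra_simps)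
    moreover have "1 + (of_nat k :: 'k) \<noteq> 0" for k
      by (metis of_nat_Suc of_nat_neq_0)
    ultimately show "poly ((shift_poly ^^ k) ([:- \<alpha> 1, 1:] ^ n 1)) (\<alpha> 1 + 1) \<noteq> 0" for k
      by (simp add: poly_power algebra_simps)
    show "surj (\<lambda>p. poly p (\<alpha> 1 + 1))"
      by (rule surjI[where f = "\<lambda>a. [:a:]"]) simp
  qed (use assms in simp_all)
next
  fix \<xi> :: 'k
  assume xi: "\<xi> \<noteq> 0 \<and> (\<forall>m::nat. m > 0 \<longrightarrow> \<xi> ^ m \<noteq> 1) \<and> poly f 0 \<noteq> 0
        \<and> (\<forall>a b. poly f a = 0 \<and> poly f b = 0 \<and> a \<noteq> b \<longrightarrow> b \<notin> int_orbit (\<lambda>x. inverse \<xi> * x) a)"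
  have "poly f (\<alpha> 1) = 0"
    using assms(2) bij_betwE[OF assms(3)] by auto
  then have alpha: "\<alpha> 1 \<noteq> 0"
    using xi by auto
  \<comment> \<open>Evaluation of Laurent polynomials at \<open>c\<close>; for
    \<open>c \<noteq> 0\<close> the map \<open>m \<mapsto> c powi m\<close> is a character of the
    integers.\<close>
  let ?ev = "\<lambda>c::'k. monoid_algebra_eval (\<lambda>a. a) (\<lambda>m. c powi m)"
  have hom: "monoid_algebra_hom (\<lambda>a. a) (\<lambda>m. c powi m)" if "c \<noteq> 0" for c :: 'k
    by unfold_locales (use that in \<open>simp_all add: power_int_add\<close>)
  note ev = monoid_algebra_hom.ev_one[OF hom] monoid_algebra_hom.ev_add[OF hom]
    monoid_algebra_hom.ev_mult[OF hom] monoid_algebra_hom.ev_diff[OF hom]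
    monoid_algebra_hom.ev_power[OF hom] monoid_algebra_hom.ev_single[OF hom]
  let ?c = "\<alpha> 1 * \<xi>"
  have c: "?c \<noteq> 0"
    using alpha xi by simp
  show "\<not> noetherian_ring
          (B_ring (scale_laurent \<xi>) (\<lambda>i. (laurent_z - laurent_const (\<alpha> i)) ^ n i) r)"
  proof (rule not_noetherian_B_ring[where h = "?ev ?c"])
    show "surj (?ev ?c)"
      by (rule surjI[where f = laurent_const]) (use c in \<open>simp add: laurent_const_def ev\<close>)
    \<comment> \<open>The factor \<open>\<xi> powi m\<close> on each coefficient is absorbed into
      the evaluation point.\<close>
    have scale: "?ev c (scale_laurent \<xi> p) = ?ev (c * \<xi>) p" for c p
      by (simp add: monoid_algebra_eval_def lookup_scale_laurent power_int_mult_distrib ac_simps)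
    have iterate: "?ev c ((scale_laurent \<xi> ^^ k) p) = ?ev (c * \<xi> ^ k) p" for c k p
      by (induction k arbitrary: c) (simp_all add: scale ac_simps)
    show "?ev ?c ((scale_laurent \<xi> ^^ k) ((laurent_z - laurent_const (\<alpha> 1)) ^ n 1)) \<noteq> 0" for k
    proof -
      \<comment> \<open>The value sought is \<open>(\<alpha> 1 * (\<xi> ^ Suc k - 1)) ^ n 1\<close>.
        The extra factor \<open>\<xi>\<close> in \<open>?c\<close> makes the exponent positive, so
        that \<open>\<xi>\<close> not being a root of unity applies even for
        \<open>k = 0\<close>.\<close>
      have "\<xi> ^ Suc k \<noteq> 1"
        using xi by blast
      then have "\<alpha> 1 * \<xi> * \<xi> ^ k - \<alpha> 1 \<noteq> 0"
        using alpha by simp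
      then show ?thesis
        using c xi by (simp add: iterate ev laurent_z_def laurent_const_def)
    qed
  qed (use assms(2) c in \<open>simp_all add: ev\<close>)
qed

end
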